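(* Let $d \ge 2$ be an integer and $\varepsilon > 0$. Then there exists $n_0 = n_0(d,\varepsilon)$ such that for every integer $n \ge n_0$ the $d$-dimensional unit cube $[0,1]^d$ can be decomposed into exactly $n$ smaller cubes in such a way that: - the ratio of the largest side length among these cubes to the smallest one is at most $1+\varepsilon$; - the cubes have at most $d+2$ different side lengths.
   Context: A decomposition (tiling) of a cube $C$ into cubes is a finite collection of $d$-dimensional cubes with pairwise disjoint interiors whose union is $C$. *)

theory Defs
  imports "HOL-Analysis.Analysis"
begin

text \<open>A cube of side length \<open>s\<close> is any congruent copy of \<open>[0,s]\<^sup>d\<close>; its edges need not be
  parallel to the coordinate axes.\<close>

definition cube_of_side :: "real \<Rightarrow> (real ^ 'd) set \<Rightarrow> bool" where
  "cube_of_side s Q \<longleftrightarrow>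
     s > 0 \<and> (\<exists>a (f :: real ^ 'd \<Rightarrow> real ^ 'd).
       orthogonal_transformation f \<and> Q = (\<lambda>x. a + f x) ` cbox 0 (vec s))"

definition is_cube :: "(real ^ 'd) set \<Rightarrow> bool" where
  "is_cube Q \<longleftrightarrow> (\<exists>s. cube_of_side s Q)"

definition side_length :: "(real ^ 'd) set \<Rightarrow> real" where
  "side_length Q = (THE s. cube_of_side s Q)"

definition cube_decomposition :: "(real ^ 'd) set \<Rightarrow> (real ^ 'd) set set \<Rightarrow> bool" where
  "cube_decomposition C T \<longleftrightarrow>
     finite T \<and> (\<forall>Q\<in>T. is_cube Q) \<and>
     pairwise (\<lambda>P Q. interior P \<inter> interior Q = {}) T \<and> \<Union>T = C"

lemma diameter_cube_of_side:
  fixes Q :: "(real ^ 'd) set"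
  assumes "cube_of_side s Q"
  shows "diameter Q = s * norm (vec 1 :: real ^ 'd)"
proof -
  let ?C = "cbox 0 (vec s) :: (real ^ 'd) set"
  obtain a and f :: "real ^ 'd \<Rightarrow> real ^ 'd" where s: "s > 0" and f: "orthogonal_transformation f"
    and Q: "Q = (\<lambda>x. a + f x) ` ?C"
    using assms by (auto simp: cube_of_side_def)
  have d: "dist (f x) (f y) = dist x y" for x y
    using f by (simp add: orthogonal_transformation_isometry)
  have "(\<lambda>(x, y). dist x y) ` (Q \<times> Q) = (\<lambda>(x, y). dist x y) ` (?C \<times> ?C)"
    unfolding Q map_prod_surj_on[OF refl refl, symmetric] image_image
    by (simp add: d case_prod_unfold)
  moreover have "?C \<noteq> {}"
    using s by (auto simp: interval_ne_empty_cart)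
  ultimately have "diameter Q = diameter ?C"
    unfolding diameter_def Q by auto
  also have "\<dots> = norm (vec s :: real ^ 'd)"
    using s by (subst diameter_cbox) (auto simp: Basis_vec_def inner_axis)
  also have "(vec s :: real ^ 'd) = s *\<^sub>R vec 1"
    by (simp add: vec_eq_iff)
  finally show ?thesis
    using s by simp
qed

lemma cube_of_side_unique:
  fixes Q :: "(real ^ 'd) set"
  assumes "cube_of_side s Q" "cube_of_side t Q"
  shows "s = t"
proof -
  have "norm (vec 1 :: real ^ 'd) \<noteq> 0"
    by (simp add: vec_eq_iff)
  then show ?thesis
    using diameter_cube_of_side[OF assms(1)] diameter_cube_of_side[OF assms(2)] by simp
qed

lemma side_length_eq: "cube_of_side s Q \<Longrightarrow> side_length Q = s"
  unfolding side_length_def by (blast intro: the_equality cube_of_side_unique)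

end

theory Submission
  imports Defs "HOL-Number_Theory.Cong"
begin

text \<open>
  Start from the grid of \<open>N\<^sup>d\<close> cubes of side \<open>1/N\<close>. Replacing a block of \<open>k\<^sup>d\<close> cells by
  \<open>(k+1)\<^sup>d\<close> equal cubes increases the number of cubes by \<open>(k+1)\<^sup>d - k\<^sup>d\<close> and changes
  the side length by the factor \<open>k/(k+1)\<close>. Fix a large \<open>K\<close>, and use blocks of the two
  sizes \<open>K\<close> and \<open>M = A K\<close>, where \<open>A = (K+1)\<^sup>d - K\<^sup>d\<close>. The two increments are \<open>A\<close> and
  \<open>B = (M+1)\<^sup>d - M\<^sup>d\<close>, and \<open>B \<equiv> 1\<close> modulo \<open>A\<close>, so every integer \<open>\<ge> A B\<close> is a
  nonnegative combination of them. Taking the largest \<open>N\<close> with \<open>N\<^sup>d + A B \<le> n\<close>, the number of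
  replacements needed to reach \<open>n\<close> is of order \<open>N\<^sup>d\<^sup>-\<^sup>1\<close>, and hence smaller than the number
  of disjoint blocks available, which is of order \<open>N\<^sup>d\<close>. Only three side lengths occur.
\<close>

section \<open>Cubes and grids\<close>

definition grid_cell :: "real ^ 'd \<Rightarrow> real \<Rightarrow> ('d \<Rightarrow> nat) \<Rightarrow> (real ^ 'd) set" where
  "grid_cell p s v = cbox (\<chi> i. p $ i + s * real (v i)) (\<chi> i. p $ i + s * (real (v i) + 1))"

text \<open>Over \<open>UNIV\<close> extensionality is vacuous, so the indices are all functions
  with values below \<open>k\<close>; this form makes \<open>card_PiE\<close> and
  \<open>finite_PiE\<close> applicable.\<close>

definition grid :: "real ^ 'd \<Rightarrow> real \<Rightarrow> nat \<Rightarrow> (real ^ 'd) set set" where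
  "grid p s k = grid_cell p s ` (UNIV \<rightarrow>\<^sub>E {..<k})"

lemma cube_of_side_cbox:
  assumes "s > 0"
  shows "cube_of_side s (cbox p (p + vec s))"
  unfolding cube_of_side_def
proof (intro conjI exI)
  show "orthogonal_transformation (\<lambda>x::real^'d. x)"
    by (rule orthogonal_transformation_id)
  show "cbox p (p + vec s) = (\<lambda>x. p + x) ` cbox 0 (vec s)"
    using cbox_translation[of p 0 "vec s"] by simp
qed (use assms in simp)

lemma cube_of_side_grid_cell:
  assumes "s > 0"
  shows "cube_of_side s (grid_cell p s v)"
proof -
  have "grid_cell p s v = cbox (\<chi> i. p $ i + s * real (v i)) ((\<chi> i. p $ i + s * real (v i)) + vec s)"
    unfolding grid_cell_def by (rule arg_cong2[where f=cbox]) (auto simp: vec_eq_iff algebra_simps)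
  then show ?thesis
    by (simp only: cube_of_side_cbox[OF assms])
qed

text \<open>Splits the isometry into an injective linear map and a translation, both of which have
  ready rules for convexity, closedness and interiors.\<close>

lemma cube_of_sideE:
  fixes Q :: "(real ^ 'd) set"
  assumes "cube_of_side s Q"
  obtains a and f :: "real ^ 'd \<Rightarrow> real ^ 'd" where "s > 0" "linear f" "inj f"
    "Q = (+) a ` f ` cbox 0 (vec s)"
proof -
  obtain a and f :: "real ^ 'd \<Rightarrow> real ^ 'd" where "s > 0" and f: "orthogonal_transformation f"
    and "Q = (\<lambda>x. a + f x) ` cbox 0 (vec s)"
    using assms unfolding cube_of_side_def by blast
  then show thesis
    using that[of f a] orthogonal_transformation_linear[OF f] orthogonal_transformation_inj[OF f]
    by (simp add: image_image)
qed

section \<open>Topology of cubes in arbitrary position\<close>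

lemma convex_cube: "cube_of_side s Q \<Longrightarrow> convex Q"
  by (metis cube_of_sideE convex_translation convex_linear_image convex_box(1))

lemma closed_cube: "cube_of_side s Q \<Longrightarrow> closed Q"
  by (metis cube_of_sideE closed_translation closed_injective_linear_image closed_cbox)

lemma interior_cube_nonempty:
  fixes Q :: "(real ^ 'd) set"
  assumes "cube_of_side s Q"
  shows "interior Q \<noteq> {}"
proof -
  obtain a and f :: "real ^ 'd \<Rightarrow> real ^ 'd" where s: "s > 0" and f: "linear f" "inj f"
    and Q: "Q = (+) a ` f ` cbox 0 (vec s)"
    using assms by (rule cube_of_sideE)
  have "box 0 (vec s) \<noteq> ({} :: (real ^ 'd) set)"
    using s by (simp add: interval_ne_empty_cart)
  then show ?thesis
    unfolding Q interior_translation interior_injective_linear_image[OF f] interior_cbox by simp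
qed

lemma closure_interior_cube:
  assumes "cube_of_side s Q"
  shows "closure (interior Q) = Q"
  using convex_closure_interior[OF convex_cube interior_cube_nonempty] closed_cube assms
  by fastforce

text \<open>In a coordinate where the indices differ, the open intervals spanned by the two cells
  are disjoint.\<close>

lemma grid_cell_interior_disjoint:
  assumes "s > 0" "v \<noteq> w"
  shows "interior (grid_cell p s v) \<inter> interior (grid_cell p s w) = {}"
proof -
  have aux: False
    if i: "v i < w i" and x: "x \<in> interior (grid_cell p s v)" "x \<in> interior (grid_cell p s w)"
    for v w :: "'a \<Rightarrow> nat" and i x
  proof -
    have "x $ i < p $ i + s * (real (v i) + 1)" "p $ i + s * real (w i) < x $ i"
      using x by (auto simp: grid_cell_def interior_cbox mem_box_cart)
    moreover have "s * (real (v i) + 1) \<le> s * real (w i)"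
      using i assms(1) by (intro mult_left_mono) auto
    ultimately show False
      by linarith
  qed
  obtain i where "v i < w i \<or> w i < v i"
    using assms(2) by (metis ext linorder_neqE_nat)
  then show ?thesis
    using aux by blast
qed

text \<open>One cell with two indices would have an interior disjoint from itself, hence
  empty.\<close>

lemma inj_grid_cell:
  assumes "s > 0"
  shows "inj (grid_cell p s)"
  using grid_cell_interior_disjoint[OF assms] interior_cube_nonempty[OF cube_of_side_grid_cell[OF assms]]
  by (metis Int_absorb injI)

section \<open>Grids as decompositions\<close>

lemma card_grid:
  fixes p :: "real ^ 'd"
  assumes "s > 0"
  shows "card (grid p s k) = k ^ CARD('d)"
  unfolding grid_def
  by (subst card_image) (auto intro: inj_on_subset[OF inj_grid_cell[OF assms]] simp: card_PiE)

lemma Union_grid: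
  assumes "s > 0" "k > 0"
  shows "\<Union> (grid p s k) = cbox p (p + vec (real k * s))"
proof (intro equalityI subsetI)
  fix x assume "x \<in> \<Union> (grid p s k)"
  then obtain v where v: "\<And>i. v i < k" and x: "x \<in> grid_cell p s v"
    by (auto simp: grid_def)
  have "p $ i \<le> x $ i \<and> x $ i \<le> p $ i + real k * s" for i
  proof -
    have "p $ i + s * real (v i) \<le> x $ i" "x $ i \<le> p $ i + s * (real (v i) + 1)"
      using x by (auto simp: grid_cell_def mem_box_cart)
    moreover have "0 \<le> s * real (v i)"
      using assms by simp
    moreover have "s * (real (v i) + 1) \<le> s * real k"
      using v[of i] assms by (intro mult_left_mono) auto
    ultimately show ?thesis
      by (simp add: mult.commute)
  qed
  then show "x \<in> cbox p (p + vec (real k * s))"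
    by (simp add: mem_box_cart)
next
  fix x assume x: "x \<in> cbox p (p + vec (real k * s))"
  \<comment> \<open>The floor finds the cell containing \<open>x\<close>; the cap at
    \<open>k - 1\<close> handles the far face, where the floor would be \<open>k\<close>.\<close>
  define v where "v i = min (k - 1) (nat \<lfloor>(x $ i - p $ i) / s\<rfloor>)" for i
  have "p $ i + s * real (v i) \<le> x $ i \<and> x $ i \<le> p $ i + s * (real (v i) + 1)" for i
  proof -
    define y where "y = (x $ i - p $ i) / s"
    have y: "x $ i = p $ i + s * y"
      using assms by (simp add: y_def)
    have "0 \<le> y" "y \<le> real k"
      using x assms by (auto simp: y_def mem_box_cart field_simps)
    then have "real (v i) \<le> y" "y \<le> real (v i) + 1"
      using assms unfolding v_def y_def[symmetric] by (auto simp: min_def) linarith+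
    then show ?thesis
      using assms by (auto simp: y)
  qed
  then have "x \<in> grid_cell p s v"
    by (simp add: grid_cell_def mem_box_cart)
  moreover have "v i < k" for i
    using assms by (auto simp: v_def min_def)
  ultimately show "x \<in> \<Union> (grid p s k)"
    by (auto simp: grid_def)
qed

lemma cube_decomposition_grid:
  assumes "s > 0" "k > 0"
  shows "cube_decomposition (cbox p (p + vec (real k * s))) (grid p s k)"
  unfolding cube_decomposition_def
proof (intro conjI ballI)
  show "finite (grid p s k)"
    unfolding grid_def by (intro finite_imageI finite_PiE) auto
  show "is_cube Q" if "Q \<in> grid p s k" for Q
    using that cube_of_side_grid_cell[OF assms(1)] by (auto simp: grid_def is_cube_def)
  show "pairwise (\<lambda>P Q. interior P \<inter> interior Q = {}) (grid p s k)"
    unfolding grid_def by (auto intro!: pairwiseI grid_cell_interior_disjoint[OF assms(1)])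
qed (rule Union_grid[OF assms])

lemma side_length_grid:
  assumes "s > 0" "Q \<in> grid p s k"
  shows "side_length Q = s"
  using assms(2) side_length_eq[OF cube_of_side_grid_cell[OF assms(1)]] by (auto simp: grid_def)

lemma grid_cell_shift:
  "grid_cell (\<chi> i. s * real (u i)) s w = grid_cell 0 s (\<lambda>i. u i + w i)"
  by (simp add: grid_cell_def algebra_simps)

section \<open>Replacing parts of a decomposition\<close>

text \<open>An open set missing \<open>interior Q\<close> also misses its closure, which for a cube
  is \<open>Q\<close> itself.\<close>

lemma interior_disjoint_Union_cubes:
  assumes "finite G" "\<forall>Q\<in>G. is_cube Q" "open U" "\<And>Q. Q \<in> G \<Longrightarrow> U \<inter> interior Q = {}"
  shows "U \<inter> \<Union>G = {}"
proof -
  have "U \<inter> Q = {}" if "Q \<in> G" for Q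
    using open_Int_closure_eq_empty[OF assms(3), of "interior Q"] closure_interior_cube assms(2,4) that
    unfolding is_cube_def by metis
  then show ?thesis
    by blast
qed

text \<open>The new cubes lie in \<open>\<Union>G\<close>, which the interior of every remaining old
  cube avoids. The second conclusion keeps the cardinality count exact.\<close>

lemma cube_decomposition_replace:
  assumes T: "cube_decomposition C T" and "G \<subseteq> T"
    and G: "cube_decomposition D G" and H: "cube_decomposition D H"
  shows "cube_decomposition C (T - G \<union> H)" "(T - G) \<inter> H = {}"
proof -
  have disj: "interior P \<inter> interior Q = {}" if "P \<in> T - G" "Q \<in> H" for P Q
  proof -
    have "interior P \<inter> \<Union>G = {}"
    proof (rule interior_disjoint_Union_cubes)
      show "interior P \<inter> interior R = {}" if "R \<in> G" for R
        using T \<open>P \<in> T - G\<close> that assms(2)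
        by (intro pairwiseD[of "\<lambda>P Q. interior P \<inter> interior Q = {}" T])
          (auto simp: cube_decomposition_def)
    qed (use G in \<open>auto simp: cube_decomposition_def\<close>)
    moreover have "Q \<subseteq> \<Union>G"
      using G H that by (auto simp: cube_decomposition_def)
    ultimately show ?thesis
      using interior_subset[of Q] by blast
  qed
  show "(T - G) \<inter> H = {}"
  proof (rule ccontr)
    assume "(T - G) \<inter> H \<noteq> {}"
    then obtain P where P: "P \<in> T - G" "P \<in> H"
      by blast
    then have "interior P = {}" "is_cube P"
      using disj[of P P] T by (auto simp: cube_decomposition_def)
    then show False
      using interior_cube_nonempty is_cube_def by blast
  qed
  have "\<Union>(T - G \<union> H) = \<Union>T"
    using G H assms(2) by (auto simp: cube_decomposition_def)
  moreover have "pairwise (\<lambda>P Q. interior P \<inter> interior Q = {}) (T - G \<union> H)"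
  proof (rule pairwiseI)
    fix P Q assume PQ: "P \<in> T - G \<union> H" "Q \<in> T - G \<union> H" "P \<noteq> Q"
    have "interior P \<inter> interior Q = {}" if "P \<in> T" "Q \<in> T"
      using T that PQ(3) by (simp add: cube_decomposition_def pairwise_def)
    moreover have "interior P \<inter> interior Q = {}" if "P \<in> H" "Q \<in> H"
      using H that PQ(3) by (simp add: cube_decomposition_def pairwise_def)
    ultimately show "interior P \<inter> interior Q = {}"
      using PQ(1,2) disj[of P Q] disj[of Q P] by blast
  qed
  ultimately show "cube_decomposition C (T - G \<union> H)"
    using T H by (auto simp: cube_decomposition_def)
qed

text \<open>The groups are exchanged one at a time; since they are disjoint, each later group
  survives the earlier exchanges. The count is an equation between sums, which avoids truncated
  subtraction.\<close>

lemma cube_decomposition_replace_family: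
  assumes "finite I" "cube_decomposition C T" "\<And>i. i \<in> I \<Longrightarrow> G i \<subseteq> T"
    "\<And>i. i \<in> I \<Longrightarrow> cube_decomposition (D i) (G i)"
    "\<And>i. i \<in> I \<Longrightarrow> cube_decomposition (D i) (H i)"
    "disjoint_family_on G I"
  shows "cube_decomposition C (T - \<Union>(G ` I) \<union> \<Union>(H ` I)) \<and>
    card (T - \<Union>(G ` I) \<union> \<Union>(H ` I)) + (\<Sum>i\<in>I. card (G i)) = card T + (\<Sum>i\<in>I. card (H i))"
  using assms
proof (induction I arbitrary: T rule: finite_induct)
  case empty
  then show ?case by simp
next
  case (insert j I)
  let ?T = "T - G j \<union> H j"
  note Gj = insert.prems(2)[of j, simplified] and Dj = insert.prems(3)[of j, simplified]
    and Hj = insert.prems(4)[of j, simplified]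
  note repl = cube_decomposition_replace[OF insert.prems(1) Gj Dj Hj]
  have GI: "G i \<inter> G j = {}" if "i \<in> I" for i
    using insert.prems(5) insert.hyps that by (auto simp: disjoint_family_on_def)
  have sub: "G i \<subseteq> T - G j" if "i \<in> I" for i
    using GI[OF that] insert.prems(2)[of i] that by blast
  have "cube_decomposition C (?T - \<Union>(G ` I) \<union> \<Union>(H ` I)) \<and>
    card (?T - \<Union>(G ` I) \<union> \<Union>(H ` I)) + (\<Sum>i\<in>I. card (G i)) = card ?T + (\<Sum>i\<in>I. card (H i))"
  proof (rule insert.IH[OF repl(1)])
    show "G i \<subseteq> ?T" if "i \<in> I" for i
      using sub[OF that] by blast
    show "disjoint_family_on G I"
      using insert.prems(5) by (auto simp: disjoint_family_on_def)
  qed (use insert.prems(3,4) in auto)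
  \<comment> \<open>No cube of \<open>H j\<close> is removed later: each \<open>G i\<close> lies in
    \<open>T - G j\<close>, which is disjoint from \<open>H j\<close>.\<close>
  moreover have "?T - \<Union>(G ` I) \<union> \<Union>(H ` I) = T - \<Union>(G ` insert j I) \<union> \<Union>(H ` insert j I)"
    using sub repl(2) by auto
  moreover have "card ?T + card (G j) = card T + card (H j)"
  proof -
    have fin: "finite T" "finite (G j)" "finite (H j)"
      using insert.prems(1) Dj Hj by (auto simp: cube_decomposition_def)
    have "card ?T = card (T - G j) + card (H j)"
      using repl(2) fin by (intro card_Un_disjoint) auto
    moreover have "card (T - G j) + card (G j) = card T"
      using fin Gj by (simp add: card_Diff_subset card_mono)
    ultimately show ?thesis
      by simp
  qed
  ultimately show ?case
    using insert.hyps by simp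
qed

section \<open>Arithmetic\<close>

text \<open>Solving \<open>y * b = t\<close> modulo \<open>a\<close> with \<open>y < a\<close> gives
  \<open>y * b \<le> a * b \<le> t\<close>, and the rest is a multiple of \<open>a\<close>.\<close>

lemma coprime_linear_combination_nat:
  fixes a b t :: nat
  assumes "coprime a b" "a > 0" "t \<ge> a * b"
  shows "\<exists>x y. t = x * a + y * b"
proof -
  obtain z where z: "[b * z = t] (mod a)"
  proof -
    obtain x where "[b * x = 1] (mod a)"
      using cong_solve_coprime_nat[of b a] assms(1) by (auto simp: coprime_commute)
    from cong_scalar_right[OF this, of t] show thesis
      using that[of "x * t"] by (simp add: mult.assoc)
  qed
  define y where "y = z mod a"
  have y: "[y * b = t] (mod a)"
    using z by (simp add: y_def cong_def mult.commute[of b] mod_mult_left_eq)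
  have "y < a"
    using assms(2) by (simp add: y_def)
  then have le: "y * b \<le> t"
    using assms(3) by (meson le_trans less_imp_le mult_le_mono1)
  then have "a dvd t - y * b"
    using y by (metis cong_sym cong_altdef_nat)
  then obtain x where "t - y * b = a * x" ..
  then have "t = x * a + y * b"
    using le by (simp add: mult.commute)
  then show ?thesis
    by blast
qed

lemma coprime_diff_powers:
  fixes A K d :: nat
  assumes "d > 0"
  shows "coprime A ((A * K + 1) ^ d - (A * K) ^ d)"
proof -
  have "A dvd (A * K) ^ d"
    using assms by (meson dvd_power dvd_trans dvd_triv_left)
  \<comment> \<open>The subtrahend is added back because subtraction on naturals truncates; the
    monotonicity shown next cancels it.\<close>
  then have "[(A * K + 1) ^ d - (A * K) ^ d + (A * K) ^ d = (A * K + 1) ^ d - (A * K) ^ d] (mod A)"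
    by (auto simp: cong_def elim!: dvdE)
  moreover have "(A * K) ^ d \<le> (A * K + 1) ^ d"
    by (intro power_mono) auto
  moreover have "[A * K + 1 = 1] (mod A)"
    by (metis cong_def mod_mult_self4)
  from cong_pow[OF this, of d] have "[(A * K + 1) ^ d = 1] (mod A)"
    by simp
  ultimately have "[(A * K + 1) ^ d - (A * K) ^ d = 1] (mod A)"
    by (simp add: cong_def)
  then show ?thesis
    by (metis coprime_1_right cong_imp_coprime cong_sym coprime_commute)
qed

text \<open>After division by \<open>N ^ d\<close> the left side tends to 0, whereas the right side
  stays above a positive constant.\<close>

lemma eventually_blocks_suffice:
  fixes c M d :: nat
  assumes "M > 0" "d > 0"
  shows "eventually (\<lambda>N. (N + 1) ^ d - N ^ d + c \<le> (N div M) ^ d) at_top"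
proof -
  have "((\<lambda>N. (1 + 1 / real N) ^ d - 1 + real c * (1 / real N) ^ d) \<longlongrightarrow> (1 + 0) ^ d - 1 + real c * 0 ^ d) at_top"
    by (intro tendsto_intros lim_1_over_n)
  then have "eventually (\<lambda>N. (1 + 1 / real N) ^ d - 1 + real c * (1 / real N) ^ d < (1 / (2 * real M)) ^ d) at_top"
    using assms by (intro order_tendstoD(2)) (auto simp: zero_power)
  then show ?thesis
    using eventually_ge_at_top[of M]
  proof eventually_elim
    case (elim N)
    have N: "N > 0"
      using elim assms by linarith
    have "(1 + 1 / real N) ^ d * real N ^ d = (real N + 1) ^ d" "(1 / real N) ^ d * real N ^ d = 1"
      using N by (simp_all add: power_mult_distrib[symmetric] field_simps)
    then have "(real N + 1) ^ d - real N ^ d + real c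
      = ((1 + 1 / real N) ^ d - 1 + real c * (1 / real N) ^ d) * real N ^ d"
      by (simp add: algebra_simps)
    also have "\<dots> \<le> (1 / (2 * real M)) ^ d * real N ^ d"
      using elim by (intro mult_right_mono) auto
    also have "\<dots> = (real N / (2 * real M)) ^ d"
      by (simp add: power_mult_distrib[symmetric])
    also have "\<dots> \<le> real (N div M) ^ d"
    proof (rule power_mono)
      have "M * (N div M) + N mod M = N" "N mod M < M" "M * 1 \<le> M * (N div M)"
        using assms elim by (auto simp: div_greater_zero_iff Suc_le_eq)
      \<comment> \<open>As \<open>N \<ge> M\<close>, the full blocks cover at least half of
        \<open>N\<close>; hence the constant \<open>1 / (2 * M)\<close> above.\<close>
      then have "N \<le> 2 * M * (N div M)"
        by linarith
      then have "real N \<le> 2 * real M * real (N div M)"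
        by (metis of_nat_le_iff of_nat_mult of_nat_numeral)
      then show "real N / (2 * real M) \<le> real (N div M)"
        using assms by (simp add: field_simps)
    qed auto
    finally have "real ((N + 1) ^ d + c) \<le> real (N ^ d + (N div M) ^ d)"
      by (simp add: add.commute)
    then have "(N + 1) ^ d + c \<le> N ^ d + (N div M) ^ d"
      by (simp only: of_nat_le_iff)
    moreover have "N ^ d \<le> (N + 1) ^ d"
      by (intro power_mono) auto
    ultimately show ?case
      by linarith
  qed
qed

section \<open>The decomposition\<close>

text \<open>\<open>S\<close> selects blocks of edge \<open>M\<close> cells in the grid of
  \<open>N\<close> cells per edge. In block \<open>v\<close> only the corner subcube of
  \<open>k v\<close> cells per edge is recut. A common spacing \<open>M\<close> for all
  \<open>k v\<close> makes disjointness easy.\<close>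

lemma unit_cube_decomposition_with_blocks:
  fixes N M :: nat and S :: "('d::finite \<Rightarrow> nat) set" and k :: "('d \<Rightarrow> nat) \<Rightarrow> nat"
  assumes "N > 0" "M > 0" and S: "S \<subseteq> UNIV \<rightarrow>\<^sub>E {..<N div M}"
    and k: "\<And>v. v \<in> S \<Longrightarrow> 0 < k v \<and> k v \<le> M"
  shows "\<exists>T :: (real ^ 'd) set set. cube_decomposition (cbox 0 (vec 1)) T \<and>
    card T = N ^ CARD('d) + (\<Sum>v\<in>S. (k v + 1) ^ CARD('d) - k v ^ CARD('d)) \<and>
    side_length ` T \<subseteq> insert (1 / N) ((\<lambda>v. k v / (k v + 1) / N) ` S)"
proof -
  define s where "s = 1 / real N"
  \<comment> \<open>Chosen so that \<open>k v + 1\<close> new edges fill the length of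
    \<open>k v\<close> old ones.\<close>
  define s' where "s' v = s * real (k v) / (real (k v) + 1)" for v
  have s: "s > 0"
    using assms by (simp add: s_def)
  have s': "s' v > 0" if "v \<in> S" for v
    using s k[OF that] by (simp add: s'_def)
  define p :: "('d \<Rightarrow> nat) \<Rightarrow> real ^ 'd" where "p v = (\<chi> i. s * real (v i * M))" for v
  define G where "G v = grid (p v) s (k v)" for v
  define H where "H v = grid (p v) (s' v) (k v + 1)" for v
  define T0 where "T0 = grid (0 :: real ^ 'd) s N"
  define T where "T = T0 - \<Union>(G ` S) \<union> \<Union>(H ` S)"
  have fin: "finite S"
    using S by (rule finite_subset) (intro finite_PiE, auto)
  have T0: "cube_decomposition (cbox 0 (vec 1)) T0"
    using cube_decomposition_grid[OF s assms(1), of 0] assms(1) by (simp add: s_def T0_def)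
  \<comment> \<open>Division of a cell's index by \<open>M\<close> recovers its block, which later
    separates the sets \<open>G v\<close>.\<close>
  have G_cell: "\<exists>w. Q = grid_cell 0 s w \<and> (\<forall>i. w i div M = v i) \<and> (\<forall>i. w i < N)"
    if v: "v \<in> S" and Q: "Q \<in> G v" for v Q
  proof -
    obtain u where u_in: "u \<in> UNIV \<rightarrow>\<^sub>E {..<k v}" and Qu: "Q = grid_cell (p v) s u"
      using Q unfolding G_def grid_def by blast
    have u: "u i < k v" for i
      using u_in by auto
    let ?w = "\<lambda>i. v i * M + u i"
    have "Q = grid_cell 0 s ?w"
      unfolding Qu p_def by (rule grid_cell_shift)
    moreover have uM: "u i < M" for i
      using u[of i] k[OF v] by linarith
    moreover have "?w i < N" for i
    proof -
      have "v i + 1 \<le> N div M"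
        using S v by (auto simp: Suc_le_eq PiE_def Pi_def)
      then have "(v i + 1) * M \<le> N div M * M"
        by (rule mult_le_mono1)
      also have "\<dots> \<le> N"
        by (rule div_times_less_eq_dividend)
      finally show ?thesis
        using uM[of i] by simp
    qed
    moreover have "?w i div M = v i" for i
      using uM[of i] by simp
    ultimately show ?thesis
      by (intro exI[of _ ?w]) auto
  qed
  have "cube_decomposition (cbox 0 (vec 1)) T \<and>
    card T + (\<Sum>v\<in>S. card (G v)) = card T0 + (\<Sum>v\<in>S. card (H v))"
    unfolding T_def
  proof (rule cube_decomposition_replace_family[OF fin T0])
    show "G v \<subseteq> T0" if "v \<in> S" for v
      using G_cell[OF that] by (fastforce simp: T0_def grid_def)
    show "cube_decomposition (cbox (p v) (p v + vec (real (k v) * s))) (G v)" if "v \<in> S" for v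
      unfolding G_def using cube_decomposition_grid s k[OF that] by blast
    have side: "real (k v + 1) * s' v = real (k v) * s" for v
      by (simp add: s'_def field_simps)
    show "cube_decomposition (cbox (p v) (p v + vec (real (k v) * s))) (H v)" if "v \<in> S" for v
      unfolding H_def using cube_decomposition_grid[OF s'[OF that], of "k v + 1" "p v"]
      unfolding side by simp
    show "disjoint_family_on G S"
      unfolding disjoint_family_on_def
    proof (intro ballI impI)
      fix v v' assume v: "v \<in> S" "v' \<in> S" "v \<noteq> v'"
      show "G v \<inter> G v' = {}"
      proof (rule ccontr)
        assume "G v \<inter> G v' \<noteq> {}"
        then obtain Q where "Q \<in> G v" "Q \<in> G v'"
          by blast
        then obtain w w' where "Q = grid_cell 0 s w" "\<forall>i. w i div M = v i"
          "Q = grid_cell 0 s w'" "\<forall>i. w' i div M = v' i"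
          using G_cell v by metis
        moreover from this have "w = w'"
          using inj_grid_cell[OF s] by (metis injD)
        ultimately show False
          using v(3) by auto
      qed
    qed
  qed
  moreover have "card T0 = N ^ CARD('d)"
    unfolding T0_def by (rule card_grid[OF s])
  moreover have "(\<Sum>v\<in>S. card (G v)) = (\<Sum>v\<in>S. k v ^ CARD('d))"
    unfolding G_def by (simp add: card_grid[OF s])
  moreover have "(\<Sum>v\<in>S. card (H v)) = (\<Sum>v\<in>S. (k v + 1) ^ CARD('d))"
    unfolding H_def by (simp add: card_grid[OF s'])
  moreover have "(\<Sum>v\<in>S. (k v + 1) ^ CARD('d)) =
    (\<Sum>v\<in>S. (k v + 1) ^ CARD('d) - k v ^ CARD('d)) + (\<Sum>v\<in>S. k v ^ CARD('d))"
    unfolding sum.distrib[symmetric] by (intro sum.cong) (auto simp: power_mono)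
  ultimately have "cube_decomposition (cbox 0 (vec 1)) T"
    "card T = N ^ CARD('d) + (\<Sum>v\<in>S. (k v + 1) ^ CARD('d) - k v ^ CARD('d))"
    by simp_all
  moreover have "side_length ` T \<subseteq> insert (1 / N) ((\<lambda>v. k v / (k v + 1) / N) ` S)"
  proof
    fix r assume "r \<in> side_length ` T"
    then obtain Q where Q: "Q \<in> T" "r = side_length Q"
      by blast
    then consider "Q \<in> T0" | v where "v \<in> S" "Q \<in> H v"
      by (auto simp: T_def)
    then show "r \<in> insert (1 / N) ((\<lambda>v. k v / (k v + 1) / N) ` S)"
    proof cases
      case 1
      then have "r = s"
        unfolding T0_def Q(2) by (rule side_length_grid[OF s])
      then show ?thesis
        by (simp add: s_def)
    next
      case (2 v)
      then have "r = s' v"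
        unfolding H_def Q(2) by (auto intro: side_length_grid[OF s'])
      then show ?thesis
        using 2(1) by (intro insertI2 image_eqI[of _ _ v]) (simp_all add: s'_def s_def mult.commute)
    qed
  qed
  ultimately show ?thesis
    by blast
qed

theorem theorem2:
  fixes \<epsilon> :: real
  assumes "CARD('d::finite) \<ge> 2" and "\<epsilon> > 0"
  shows "\<exists>n0::nat. \<forall>n\<ge>n0. \<exists>T :: (real ^ 'd) set set.
           cube_decomposition (cbox 0 (vec 1)) T \<and> card T = n \<and>
           (\<forall>Q\<in>T. side_length Q < 1) \<and>
           Max (side_length ` T) / Min (side_length ` T) \<le> 1 + \<epsilon> \<and>
           card (side_length ` T) \<le> CARD('d) + 2"
proof -
  define d where "d = CARD('d)"
  have d: "d \<ge> 2"
    using assms(1) by (simp add: d_def)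
  \<comment> \<open>The extreme sides will be \<open>1 / N\<close> and
    \<open>K / (K + 1) / N\<close>, with ratio \<open>1 + 1 / K\<close>.\<close>
  obtain K :: nat where K: "K > 0" "1 / real K < \<epsilon>"
    using assms(2) by (metis nat_approx_posE of_nat_Suc zero_less_Suc)
  define A where "A = (K + 1) ^ d - K ^ d"
  have A: "A > 0"
    using d by (simp add: A_def power_strict_mono)
  \<comment> \<open>A multiple of \<open>A\<close>, so that \<open>B\<close> is 1 modulo
    \<open>A\<close>; also \<open>K \<le> M\<close>, so the smaller recut fits in an
    \<open>M\<close>-block.\<close>
  define M where "M = A * K"
  have M: "K \<le> M" "M > 0"
    using A K by (auto simp: M_def)
  define B where "B = (M + 1) ^ d - M ^ d"
  have B: "B > 0"
    using d by (simp add: B_def power_strict_mono)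
  have AB: "coprime A B"
    unfolding B_def M_def using d by (intro coprime_diff_powers) auto
  obtain N0 where N0: "\<And>N. N \<ge> N0 \<Longrightarrow> (N + 1) ^ d - N ^ d + A * B \<le> (N div M) ^ d"
    using eventually_blocks_suffice[of M d "A * B"] M d
    unfolding eventually_at_top_linorder by auto
  show ?thesis
  \<comment> \<open>The summand 2 forces \<open>N \<ge> 2\<close>, so that even the side
    \<open>1 / N\<close> is below 1.\<close>
  proof (intro exI[of _ "(N0 + 2) ^ d + A * B"] allI impI)
    fix n assume n: "n \<ge> (N0 + 2) ^ d + A * B"
    \<comment> \<open>Leaves a surplus \<open>n - N ^ d\<close> of at least \<open>A * B\<close>,
      while maximality bounds it by about one step of the power.\<close>
    define N where "N = (GREATEST N. N ^ d + A * B \<le> n)"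
    have bound: "m \<le> n" if "m ^ d + A * B \<le> n" for m
      using that d self_le_power[of m d] by (cases "m = 0") (auto simp: Suc_le_eq)
    have N_max: "m \<le> N" if "m ^ d + A * B \<le> n" for m
      unfolding N_def using that
      by (rule Greatest_le_nat[of "\<lambda>N. N ^ d + A * B \<le> n"]) (rule bound)
    have N: "N ^ d + A * B \<le> n"
      unfolding N_def using n
      by (rule GreatestI_nat[of "\<lambda>N. N ^ d + A * B \<le> n"]) (rule bound)
    have N_ge: "N0 + 2 \<le> N"
      using n by (rule N_max)
    have "\<not> (N + 1) ^ d + A * B \<le> n"
      using N_max[of "N + 1"] by linarith
    then have upper: "n < (N + 1) ^ d + A * B"
      by simp
    have "A * B \<le> n - N ^ d"
      using N by linarith
    then obtain a b where ab: "n - N ^ d = a * A + b * B"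
      using coprime_linear_combination_nat[OF AB A] by blast
    \<comment> \<open>Each recut adds at least one cube, so the surplus bounds the number of blocks
      needed.\<close>
    have "a * 1 + b * 1 \<le> a * A + b * B"
      using A B by (intro add_mono mult_le_mono2) auto
    also have "\<dots> \<le> (N + 1) ^ d - N ^ d + A * B"
      using ab upper by linarith
    also have "\<dots> \<le> (N div M) ^ d"
      using N0 N_ge by simp
    finally have "a + b \<le> card ((UNIV :: 'd set) \<rightarrow>\<^sub>E {..<N div M})"
      by (simp add: card_PiE d_def)
    then obtain S where S: "S \<subseteq> (UNIV :: 'd set) \<rightarrow>\<^sub>E {..<N div M}" "card S = a + b" "finite S"
      using obtain_subset_with_card_n by metis
    obtain R where R: "R \<subseteq> S" "card R = a" "finite R"
      using obtain_subset_with_card_n[of a S] S(2) by auto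
    \<comment> \<open>The \<open>a\<close> blocks in \<open>R\<close> contribute \<open>A\<close>
      each, the other \<open>b\<close> contribute \<open>B\<close> each.\<close>
    define k where "k v = (if v \<in> R then K else M)" for v
    have k: "0 < k v \<and> k v \<le> M" for v
      using K M by (simp add: k_def)
    have "N > 0"
      using N_ge by simp
    obtain T :: "(real ^ 'd) set set" where T: "cube_decomposition (cbox 0 (vec 1)) T"
      "card T = N ^ d + (\<Sum>v\<in>S. (k v + 1) ^ d - k v ^ d)"
      "side_length ` T \<subseteq> insert (1 / N) ((\<lambda>v. k v / (k v + 1) / N) ` S)"
      using unit_cube_decomposition_with_blocks[where k=k, OF \<open>N > 0\<close> M(2) S(1) k]
      unfolding d_def by blast
    have "(\<Sum>v\<in>S. (k v + 1) ^ d - k v ^ d) = (\<Sum>v\<in>S - R. B) + (\<Sum>v\<in>R. A)"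
      unfolding sum.subset_diff[OF R(1) S(3)] by (simp add: k_def A_def B_def)
    also have "\<dots> = n - N ^ d"
      using S R by (simp add: card_Diff_subset ab)
    finally have card_T: "card T = n"
      using T(2) N by simp
    define x where "x = 1 / real N"
    define y where "y = real K / (real K + 1) / real N"
    define z where "z = real M / (real M + 1) / real N"
    have sides: "side_length ` T \<subseteq> {x, y, z}"
      using T(3) by (auto simp: k_def x_def y_def z_def split: if_splits)
    have "y > 0"
      using K N_ge by (simp add: y_def)
    \<comment> \<open>The function \<open>t / (t + 1)\<close> is increasing and below 1, which
      orders the three sides.\<close>
    have "y \<le> z"
      unfolding y_def z_def using M(1) by (intro divide_right_mono) (auto simp: field_simps)
    have "z \<le> x"
      unfolding x_def z_def by (intro divide_right_mono) (auto simp: field_simps)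
    have "x < 1"
      using N_ge by (simp add: x_def)
    \<comment> \<open>\<open>Max\<close> and \<open>Min\<close> need a finite nonempty set of sides;
      both properties follow from \<open>card T > 0\<close>.\<close>
    have "N ^ d > 0"
      using \<open>N > 0\<close> by simp
    then have "n > 0"
      using N by linarith
    then have "card T > 0"
      by (simp only: card_T)
    then have T_ne: "finite (side_length ` T)" "side_length ` T \<noteq> {}"
      unfolding card_gt_0_iff by simp_all
    have "Max (side_length ` T) \<in> {x, y, z}" "Min (side_length ` T) \<in> {x, y, z}"
      by (fact subsetD[OF sides Max_in[OF T_ne]] subsetD[OF sides Min_in[OF T_ne]])+
    then have "Max (side_length ` T) \<le> x" "y \<le> Min (side_length ` T)"
      using \<open>y \<le> z\<close> \<open>z \<le> x\<close> by auto
    then have "Max (side_length ` T) / Min (side_length ` T) \<le> x / y"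
      using \<open>y > 0\<close> by (intro frac_le) (auto simp: x_def)
    also have "\<dots> = 1 + 1 / real K"
      using K N_ge by (simp add: x_def y_def field_simps)
    also have "\<dots> \<le> 1 + \<epsilon>"
      using K by simp
    finally have ratio: "Max (side_length ` T) / Min (side_length ` T) \<le> 1 + \<epsilon>" .
    have "\<forall>Q\<in>T. side_length Q < 1"
    proof
      fix Q assume "Q \<in> T"
      then have "side_length Q \<in> {x, y, z}"
        by (intro subsetD[OF sides] imageI)
      then show "side_length Q < 1"
        using \<open>x < 1\<close> \<open>y \<le> z\<close> \<open>z \<le> x\<close> by auto
    qed
    moreover have "card (side_length ` T) \<le> CARD('d) + 2"
    proof -
      have "card (side_length ` T) \<le> card {x, y, z}"
        using sides by (intro card_mono) auto
      also have "\<dots> \<le> 3"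
        by (simp add: card_insert_if)
      finally show ?thesis
        using assms(1) by linarith
    qed
    ultimately show "\<exists>T :: (real ^ 'd) set set.
           cube_decomposition (cbox 0 (vec 1)) T \<and> card T = n \<and>
           (\<forall>Q\<in>T. side_length Q < 1) \<and>
           Max (side_length ` T) / Min (side_length ` T) \<le> 1 + \<epsilon> \<and>
           card (side_length ` T) \<le> CARD('d) + 2"
      using T(1) card_T ratio by blast
  qed
qed

end
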